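(* Let $S$ be the bicyclic semigroup (with the discrete topology) generated by $1$, $p$ and $q$, where $1$ is the identity and $pq=1\neq qp$. Let $\mathbb{T}=\{z\in\mathbb{C}:|z|=1\}$. Then $W_1(S)$ and $W_2(S)$ are the norm closures of the algebras generated by the sets of functions $$\{q^mp^n\mapsto\mu^{r}\nu^{1-r},\ r=m-n \;:\; \mu,\nu\in\mathbb{T}\}$$ and $$\{q^mp^n\mapsto\lambda^{\frac{r^2-r}{2}}\mu^{\frac{r^2+r}{2}}\nu^{1-r^2},\ r=m-n \;:\; \lambda,\mu,\nu\in\mathbb{T}\},$$ respectively.
   Context: Every element of the bicyclic semigroup $S$ can be written uniquely as $q^mp^n$ with integers $m,n\ge 0$, where $p^0=q^0=1$; the functions above are defined on $S$ through this normal form. For a semitopological semigroup $S$ (all left and right translations continuous), $C(S)$ is the $C^*$-algebra of bounded continuous complex-valued functions with the sup norm, and $(L_sf)(t)=f(st)$. $LMC(S)$ is the set of $f\in C(S)$ such that $s\mapsto\mu(L_sf)$ is continuous on $S$ for every $\mu$ in the spectrum of $C(S)$; it is a unital $C^*$-subalgebra, and for $\mu$ in its spectrum $S^{LMC}$ (the nonzero multiplicative linear functionals on $LMC(S)$) the formula $(T_\mu f)(s)=\mu(L_sf)$ defines a map $T_\mu:LMC(S)\to LMC(S)$. Put $\Sigma=\{T_\mu:\mu\in S^{LMC}\}$. For discrete $S$, $LMC(S)=\ell^\infty(S)$. Let $F_0$ be the set of constant functions on $S$ of modulus $1$, and inductively for $k\ge 1$ let $$F_k=\{f\in LMC(S):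 |f|=1 \text{ and for every }\sigma\in\Sigma \text{ there is } f_\sigma\in F_{k-1}\text{ with }\sigma(f)=f_\sigma f\},$$ where $|f|=1$ means $|f(s)|=1$ for all $s\in S$. Let $W_k(S)$ be the norm closure in $C(S)$ of the (complex) algebra generated by $F_k$. *)

theory Defs
  imports "HOL-Analysis.Analysis"
begin

section \<open>The spaces \<open>LMC(S)\<close> and \<open>W\<^sub>k(S)\<close> of a semitopological semigroup\<close>

text \<open>
  \<open>C(S)\<close> is the library's set \<open>bcontfun\<close> of bounded continuous functions; its sup norm is the norm
  of the library type \<open>'a \<Rightarrow>\<^sub>C complex\<close>. Subspaces of \<open>C(S)\<close> are sets of plain functions, with the
  operations taken pointwise. Nothing is assumed about the topology here: continuity of the
  translations of \<open>S\<close> is a hypothesis to be added (it is automatic when \<open>S\<close> is discrete).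
\<close>

definition left_translate :: "'a::semigroup_mult \<Rightarrow> ('a \<Rightarrow> complex) \<Rightarrow> 'a \<Rightarrow> complex" where
  "left_translate s f = (\<lambda>t. f (s * t))"

text \<open>
  The spectrum of an algebra \<open>A\<close> of functions. Functionals are total in HOL; their values outside
  \<open>A\<close> are arbitrary and are never used.
\<close>

definition spectrum :: "('a \<Rightarrow> complex) set \<Rightarrow> (('a \<Rightarrow> complex) \<Rightarrow> complex) set" where
  "spectrum A = {\<mu>.
     (\<forall>f\<in>A. \<forall>g\<in>A. \<mu> (\<lambda>s. f s + g s) = \<mu> f + \<mu> g) \<and>
     (\<forall>c. \<forall>f\<in>A. \<mu> (\<lambda>s. c * f s) = c * \<mu> f) \<and>
     (\<forall>f\<in>A. \<forall>g\<in>A. \<mu> (\<lambda>s. f s * g s) = \<mu> f * \<mu> g) \<and>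
     (\<exists>f\<in>A. \<mu> f \<noteq> 0)}"

definition LMC :: "('a::{semigroup_mult, topological_space} \<Rightarrow> complex) set" where
  "LMC = {f \<in> bcontfun. \<forall>\<mu> \<in> spectrum bcontfun. continuous_on UNIV (\<lambda>s. \<mu> (left_translate s f))}"

definition T_op :: "(('a::semigroup_mult \<Rightarrow> complex) \<Rightarrow> complex) \<Rightarrow> ('a \<Rightarrow> complex) \<Rightarrow> 'a \<Rightarrow> complex" where
  "T_op \<mu> f = (\<lambda>s. \<mu> (left_translate s f))"

definition Sigma_ops :: "(('a::{semigroup_mult, topological_space} \<Rightarrow> complex) \<Rightarrow> 'a \<Rightarrow> complex) set" where
  "Sigma_ops = T_op ` spectrum LMC"

primrec F_fun :: "nat \<Rightarrow> ('a::{semigroup_mult, topological_space} \<Rightarrow> complex) set" where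
  "F_fun 0 = {\<lambda>s. c | c. cmod c = 1}"
| "F_fun (Suc k) = {f \<in> LMC. (\<forall>s. cmod (f s) = 1) \<and>
     (\<forall>\<sigma> \<in> Sigma_ops. \<exists>g \<in> F_fun k. \<sigma> f = (\<lambda>s. g s * f s))}"

definition subalgebra :: "('a \<Rightarrow> complex) set \<Rightarrow> bool" where
  "subalgebra A \<longleftrightarrow>
     (\<lambda>s. 0) \<in> A \<and>
     (\<forall>f\<in>A. \<forall>g\<in>A. (\<lambda>s. f s + g s) \<in> A) \<and>
     (\<forall>c. \<forall>f\<in>A. (\<lambda>s. c * f s) \<in> A) \<and>
     (\<forall>f\<in>A. \<forall>g\<in>A. (\<lambda>s. f s * g s) \<in> A)"

definition closed_algebra :: "('a::topological_space \<Rightarrow> complex) set \<Rightarrow> ('a \<Rightarrow>\<^sub>C complex) set" where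
  "closed_algebra B = closure {f. apply_bcontfun f \<in> subalgebra hull B}"

definition W :: "nat \<Rightarrow> ('a::{semigroup_mult, topological_space} \<Rightarrow>\<^sub>C complex) set" where
  "W k = closed_algebra (F_fun k)"

section \<open>The bicyclic semigroup\<close>

text \<open>
  The ambient type is the bicyclic semigroup with generators \<open>p\<close> and \<open>q\<close>. By
  \<open>bicyclic_normal_form\<close> below these conditions determine it up to isomorphism.
\<close>

definition bicyclic :: "'a::monoid_mult \<Rightarrow> 'a \<Rightarrow> bool" where
  "bicyclic p q \<longleftrightarrow> p * q = 1 \<and> q * p \<noteq> 1 \<and>
     (\<lambda>T. \<forall>x\<in>T. \<forall>y\<in>T. x * y \<in> T) hull {1, p, q} = UNIV"

lemma bicyclic_power_cancel:
  fixes p q :: "'a::monoid_mult"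
  assumes "p * q = 1"
  shows "p ^ n * q ^ n = 1"
proof (induction n)
  case (Suc n)
  have "p ^ Suc n * q ^ Suc n = p ^ n * (p * q) * q ^ n"
    by (simp only: power_Suc2[of p] power_Suc[of q] mult.assoc)
  then show ?case using Suc assms by simp
qed simp

lemma bicyclic_power_mult:
  fixes p q :: "'a::monoid_mult"
  assumes "p * q = 1"
  shows "p ^ n * q ^ k = q ^ (k - n) * p ^ (n - k)"
proof (cases "n \<le> k")
  case True
  then have "q ^ k = q ^ n * q ^ (k - n)" by (simp flip: power_add)
  then show ?thesis using True bicyclic_power_cancel[OF assms, of n]
    by (simp flip: mult.assoc)
next
  case False
  then have "p ^ n = p ^ (n - k) * p ^ k" by (simp flip: power_add)
  then show ?thesis using False bicyclic_power_cancel[OF assms, of k]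
    by (simp add: mult.assoc)
qed

lemma bicyclic_powers_inj:
  fixes p q :: "'a::monoid_mult"
  assumes pq: "p * q = 1" and qp: "q * p \<noteq> 1" and eq: "q ^ m * p ^ n = q ^ k * p ^ l" and "m \<le> k"
  shows "m = k \<and> n = l"
proof -
  have no_right: "q * x \<noteq> 1" for x
    by (metis pq qp mult.assoc mult_1_left mult_1_right)
  have no_left: "x * p \<noteq> 1" for x
    by (metis pq qp mult.assoc mult_1_left mult_1_right)
  have "p ^ m * (q ^ m * p ^ n) = p ^ n"
    using bicyclic_power_cancel[OF pq, of m] by (simp flip: mult.assoc)
  moreover have "p ^ m * (q ^ k * p ^ l) = q ^ (k - m) * p ^ l"
    using bicyclic_power_mult[OF pq, of m k] \<open>m \<le> k\<close> by (simp flip: mult.assoc)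
  ultimately have e: "p ^ n = q ^ (k - m) * p ^ l" using eq by simp
  have "k - m = 0"
  proof (rule ccontr)
    assume "k - m \<noteq> 0"
    then obtain d where d: "k - m = Suc d" by (cases "k - m") auto
    have "1 = q ^ (k - m) * p ^ l * q ^ n"
      using e bicyclic_power_cancel[OF pq, of n] by simp
    then have "1 = q * (q ^ d * p ^ l * q ^ n)" by (simp add: d mult.assoc)
    then show False using no_right by metis
  qed
  then have mk: "m = k" using \<open>m \<le> k\<close> by simp
  have pn: "p ^ n = p ^ l" using e mk by simp
  have less: False if "i < j" "p ^ i = p ^ j" for i j
  proof -
    from that obtain d where d: "j - i = Suc d" by (cases "j - i") auto
    have "p ^ j * q ^ i = p ^ (j - i)"
      using bicyclic_power_mult[OF pq, of j i] that by simp
    then have "1 = p ^ (j - i)" using that bicyclic_power_cancel[OF pq, of i] by simp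
    then have "1 = p ^ d * p" unfolding d power_Suc2 .
    then show False using no_left by metis
  qed
  have "n = l" using less[of n l] less[of l n] pn by (metis nat_neq_iff)
  with mk show ?thesis by simp
qed

lemma bicyclic_normal_form:
  fixes p q :: "'a::monoid_mult"
  assumes "bicyclic p q"
  shows "\<exists>!(m, n). s = q ^ m * p ^ n"
proof -
  have pq: "p * q = 1" and qp: "q * p \<noteq> 1"
    and gen: "(\<lambda>T. \<forall>x\<in>T. \<forall>y\<in>T. x * y \<in> T) hull {1, p, q} = UNIV"
    using assms by (auto simp: bicyclic_def)
  let ?T = "{q ^ m * p ^ n | m n. True}"
  have "x * y \<in> ?T" if x: "x \<in> ?T" and y: "y \<in> ?T" for x y
  proof -
    from x obtain m n where x': "x = q ^ m * p ^ n" by blast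
    from y obtain k l where y': "y = q ^ k * p ^ l" by blast
    have "x * y = q ^ m * (p ^ n * q ^ k) * p ^ l"
      using x' y' by (simp add: mult.assoc)
    also have "\<dots> = q ^ (m + (k - n)) * p ^ ((n - k) + l)"
      by (simp add: bicyclic_power_mult[OF pq] power_add mult.assoc)
    finally show ?thesis by blast
  qed
  moreover have "1 = q ^ 0 * p ^ 0" "p = q ^ 0 * p ^ 1" "q = q ^ 1 * p ^ 0" by simp_all
  then have "{1, p, q} \<subseteq> ?T" by blast
  ultimately have "(\<lambda>T. \<forall>x\<in>T. \<forall>y\<in>T. x * y \<in> T) hull {1, p, q} \<subseteq> ?T"
    by (intro hull_minimal) blast+
  then obtain m n where mn: "s = q ^ m * p ^ n" using gen by blast
  have "i = m \<and> j = n" if "s = q ^ i * p ^ j" for i j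
    using bicyclic_powers_inj[OF pq qp, of i j m n] bicyclic_powers_inj[OF pq qp, of m n i j]
      mn that by (metis nat_le_linear)
  with mn show ?thesis by (auto intro!: ex1I[of _ "(m, n)"])
qed

end

theory Submission
  imports Defs
begin

text \<open>
  Let \<open>r\<close> be the homomorphism to the integers sending \<open>q\<^sup>m p\<^sup>n\<close> to \<open>m - n\<close>. Applying the defining
  condition of \<open>F\<^sub>k\<close> to evaluations only, \<open>f \<in> F\<^sub>1\<close> is a constant times a character of the
  bicyclic semigroup, i.e. \<open>c a\<^sup>r\<close>; and \<open>f \<in> F\<^sub>2\<close> with \<open>f(1) = 1\<close> satisfies
  \<open>f(st) = f(s) f(t) b\<^bsup>r(s) r(t)\<^esup>\<close>, so that dividing by \<open>b\<^bsup>r(r-1)/2\<^esup>\<close> leaves a character.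
  Conversely such functions belong to \<open>F\<^sub>k\<close>, because a multiplicative functional sends unimodular
  functions to unimodular numbers. Interpolating the exponents at \<open>r = -1, 0, 1\<close> gives the
  stated parametrisation, so already the generating sets coincide.
\<close>

section \<open>Multiplicative functionals on bounded functions\<close>

text \<open>On a discrete space every function is continuous, so both continuity conditions hold
  automatically and only boundedness remains.\<close>

lemma mem_LMC_discrete:
  fixes f :: "'a::{semigroup_mult, discrete_topology} \<Rightarrow> complex"
  shows "f \<in> LMC \<longleftrightarrow> bounded (range f)"
proof -
  have "continuous_on UNIV g" for g :: "'a \<Rightarrow> complex"
    by (simp add: continuous_on_open_vimage open_discrete)
  then show ?thesis by (simp add: LMC_def bcontfun_def)
qed

lemma LMC_discreteI:
  fixes f :: "'a::{semigroup_mult, discrete_topology} \<Rightarrow> complex"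
  assumes "\<And>s. cmod (f s) \<le> B"
  shows "f \<in> LMC"
  using assms by (auto simp: mem_LMC_discrete bounded_iff)

lemma one_in_LMC: "(\<lambda>s. 1) \<in> (LMC :: ('a::{semigroup_mult, discrete_topology} \<Rightarrow> complex) set)"
  by (rule LMC_discreteI[of _ 1]) simp

lemma evaluation_in_spectrum:
  assumes "(\<lambda>s. 1) \<in> A"
  shows "(\<lambda>f. f t) \<in> spectrum A"
  using assms by (auto simp: spectrum_def intro!: bexI[of _ "\<lambda>s. 1"])

lemma
  assumes "\<mu> \<in> spectrum A"
  shows spectrum_add: "f \<in> A \<Longrightarrow> g \<in> A \<Longrightarrow> \<mu> (\<lambda>s. f s + g s) = \<mu> f + \<mu> g"
    and spectrum_scale: "f \<in> A \<Longrightarrow> \<mu> (\<lambda>s. c * f s) = c * \<mu> f"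
    and spectrum_mult: "f \<in> A \<Longrightarrow> g \<in> A \<Longrightarrow> \<mu> (\<lambda>s. f s * g s) = \<mu> f * \<mu> g"
  using assms by (simp_all add: spectrum_def)

lemma spectrum_one:
  assumes "\<mu> \<in> spectrum A" "(\<lambda>s. 1) \<in> A"
  shows "\<mu> (\<lambda>s. 1) = 1"
proof -
  obtain f where f: "f \<in> A" "\<mu> f \<noteq> 0" using assms(1) by (auto simp: spectrum_def)
  then show ?thesis using spectrum_mult[OF assms(1) f(1) assms(2)] by simp
qed

context
  fixes \<mu> :: "('a::{semigroup_mult, discrete_topology} \<Rightarrow> complex) \<Rightarrow> complex"
  assumes \<mu>: "\<mu> \<in> spectrum LMC"
begin

text \<open>Functionals in the spectrum are given purely algebraically, so their norm bound comes
  from invertibility. If \<open>\<mu> f\<close> lay outside the closed unit disc,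
  \<open>f - \<mu> f\<close> would be bounded away from 0 and hence invertible in
  \<open>LMC\<close>, yet \<open>\<mu>\<close> sends it to 0.\<close>

lemma spectrum_LMC_le_one:
  assumes f: "\<And>s. cmod (f s) \<le> 1"
  shows "cmod (\<mu> f) \<le> 1"
proof (rule ccontr)
  assume "\<not> cmod (\<mu> f) \<le> 1"
  then have c: "cmod (\<mu> f) > 1" by simp
  define h where "h = (\<lambda>s. f s + (- \<mu> f) * 1)"
  define g where "g = (\<lambda>s. inverse (h s))"
  have h_ge: "cmod (h s) \<ge> cmod (\<mu> f) - 1" for s
    using norm_triangle_ineq2[of "\<mu> f" "f s"] f[of s] by (simp add: h_def norm_minus_commute)
  have "f \<in> LMC" "(\<lambda>s. - \<mu> f * 1) \<in> (LMC :: ('a \<Rightarrow> complex) set)"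
    using f by (auto intro: LMC_discreteI)
  then have "\<mu> h = \<mu> f + \<mu> (\<lambda>s. - \<mu> f * 1)"
    unfolding h_def by (rule spectrum_add[OF \<mu>])
  also have "\<mu> (\<lambda>s. - \<mu> f * 1) = - \<mu> f * \<mu> (\<lambda>s. 1)"
    by (rule spectrum_scale[OF \<mu> one_in_LMC])
  finally have h0: "\<mu> h = 0" using spectrum_one[OF \<mu> one_in_LMC] by simp
  have "cmod (g s) \<le> inverse (cmod (\<mu> f) - 1)" for s
    using h_ge[of s] c by (simp add: g_def norm_inverse le_imp_inverse_le)
  then have "g \<in> LMC" by (rule LMC_discreteI)
  moreover have "h \<in> LMC"
  proof (rule LMC_discreteI)
    show "cmod (h s) \<le> 1 + cmod (\<mu> f)" for s
      using norm_triangle_ineq4[of "f s" "\<mu> f"] f[of s] by (simp add: h_def)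
  qed
  ultimately have "\<mu> (\<lambda>s. h s * g s) = 0" using spectrum_mult[OF \<mu>] h0 by simp
  moreover have "h s * g s = 1" for s
  proof -
    have "h s \<noteq> 0" using h_ge[of s] c by auto
    then show ?thesis by (simp add: g_def)
  qed
  ultimately show False using spectrum_one[OF \<mu> one_in_LMC] by simp
qed

lemma spectrum_LMC_inverse:
  assumes f: "\<And>s. cmod (f s) = 1"
  shows "\<mu> (\<lambda>s. inverse (f s)) = inverse (\<mu> f)"
proof -
  have "f \<in> LMC" "(\<lambda>s. inverse (f s)) \<in> LMC"
    using f by (auto intro!: LMC_discreteI[of _ 1] simp: norm_inverse)
  then have "\<mu> f * \<mu> (\<lambda>s. inverse (f s)) = \<mu> (\<lambda>s. f s * inverse (f s))"
    using spectrum_mult[OF \<mu>] by simp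
  moreover have "f s * inverse (f s) = 1" for s using f[of s] by (intro right_inverse) auto
  ultimately show ?thesis
    using spectrum_one[OF \<mu> one_in_LMC] by (simp add: inverse_unique)
qed

text \<open>The bound by 1 applies to \<open>f\<close> and to its pointwise inverse, and
  \<open>\<mu>\<close> respects inverses.\<close>

lemma spectrum_LMC_unimodular:
  assumes f: "\<And>s. cmod (f s) = 1"
  shows "cmod (\<mu> f) = 1"
proof (rule antisym)
  show "cmod (\<mu> f) \<le> 1" using f by (intro spectrum_LMC_le_one) simp
  have le: "cmod (inverse (\<mu> f)) \<le> 1"
    unfolding spectrum_LMC_inverse[OF f, symmetric]
    using f by (intro spectrum_LMC_le_one) (simp add: norm_inverse)
  \<comment> \<open>Because \<open>inverse 0 = 0\<close>, the bound \<open>le\<close> does not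
    exclude \<open>\<mu> f = 0\<close>; the product being sent to 1 does.\<close>
  have "f \<in> LMC" "(\<lambda>s. inverse (f s)) \<in> LMC"
    using f by (auto intro!: LMC_discreteI[of _ 1] simp: norm_inverse)
  then have "\<mu> f * inverse (\<mu> f) = \<mu> (\<lambda>s. f s * inverse (f s))"
    using spectrum_mult[OF \<mu>] spectrum_LMC_inverse[OF f] by simp
  moreover have "f s * inverse (f s) = 1" for s using f[of s] by (intro right_inverse) auto
  ultimately have "\<mu> f \<noteq> 0" using spectrum_one[OF \<mu> one_in_LMC] by auto
  then show "1 \<le> cmod (\<mu> f)" using le by (simp add: norm_inverse inverse_le_1_iff)
qed

text \<open>For the quadratic functions: their translates by \<open>s\<close> carry a power whose
  exponent depends on \<open>s\<close>, and this takes that exponent out of the functional.\<close>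

lemma spectrum_LMC_powi:
  assumes f: "\<And>s. cmod (f s) = 1"
  shows "\<mu> (\<lambda>s. f s powi k) = \<mu> f powi k"
proof -
  have pow: "\<mu> (\<lambda>s. f s ^ n) = \<mu> f ^ n" for n
  proof (induction n)
    case 0
    then show ?case using spectrum_one[OF \<mu> one_in_LMC] by simp
  next
    case (Suc n)
    have "f \<in> LMC" "(\<lambda>s. f s ^ n) \<in> LMC"
      using f by (auto intro!: LMC_discreteI[of _ 1] simp: norm_power)
    then show ?case using Suc spectrum_mult[OF \<mu>] by simp
  qed
  show ?thesis
  proof (cases "k \<ge> 0")
    case True
    then show ?thesis using pow by (simp add: power_int_def)
  next
    case False
    have "\<mu> (\<lambda>s. inverse (f s ^ nat (- k))) = inverse (\<mu> (\<lambda>s. f s ^ nat (- k)))"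
      using f by (intro spectrum_LMC_inverse) (simp add: norm_power)
    then show ?thesis using False pow by (simp add: power_int_def power_inverse)
  qed
qed

end

section \<open>Right translations and membership in \<open>F_fun\<close>\<close>

lemma evaluation_in_Sigma_ops:
  "(\<lambda>f s. f (s * t)) \<in> (Sigma_ops :: (('a::{semigroup_mult, discrete_topology} \<Rightarrow> complex) \<Rightarrow> _) set)"
proof -
  \<comment> \<open>Evaluating all left translates of \<open>f\<close> at \<open>t\<close> yields
    the right translate of \<open>f\<close> by \<open>t\<close>.\<close>
  have "T_op (\<lambda>f. f t) \<in> (Sigma_ops :: (('a \<Rightarrow> complex) \<Rightarrow> _) set)"
    unfolding Sigma_ops_def by (intro imageI evaluation_in_spectrum one_in_LMC)
  then show ?thesis by (simp add: T_op_def[abs_def] left_translate_def)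
qed

lemma F_fun_Suc_evaluation:
  fixes f :: "'a::{semigroup_mult, discrete_topology} \<Rightarrow> complex"
  assumes "f \<in> F_fun (Suc k)"
  shows "\<exists>g \<in> F_fun k. \<forall>s. f (s * t) = g s * f s"
proof -
  have "\<forall>\<sigma> \<in> Sigma_ops. \<exists>g \<in> F_fun k. \<sigma> f = (\<lambda>s. g s * f s)" using assms by simp
  from bspec[OF this evaluation_in_Sigma_ops[of t]] show ?thesis by (simp add: fun_eq_iff)
qed

lemma F_fun_SucI:
  fixes f :: "'a::{semigroup_mult, discrete_topology} \<Rightarrow> complex"
  assumes "\<And>s. cmod (f s) = 1"
    and "\<And>\<mu>. \<mu> \<in> spectrum LMC \<Longrightarrow> \<exists>g \<in> F_fun k. T_op \<mu> f = (\<lambda>s. g s * f s)"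
  shows "f \<in> F_fun (Suc k)"
proof -
  have "f \<in> LMC" using assms(1) by (intro LMC_discreteI[of _ 1]) simp
  moreover have "\<forall>\<sigma> \<in> Sigma_ops. \<exists>g \<in> F_fun k. \<sigma> f = (\<lambda>s. g s * f s)"
    unfolding Sigma_ops_def using assms(2) by simp
  ultimately show ?thesis using assms(1) by simp
qed

section \<open>Characters of the bicyclic semigroup\<close>

lemma cmod_powi_one:
  fixes a :: complex
  assumes "cmod a = 1"
  shows "cmod (a powi k) = 1"
  using assms by (simp add: norm_power_int)

text \<open>Both differences are even, so the integer divisions are exact. The cross term
  \<open>i * j\<close> is the exponent by which the quadratic factor fails to be
  multiplicative.\<close>

lemma triangular_add:
  fixes i j :: int
  shows "((i + j)\<^sup>2 - (i + j)) div 2 = (i\<^sup>2 - i) div 2 + (j\<^sup>2 - j) div 2 + i * j"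
proof -
  have "even (i\<^sup>2 - i)" "even (j\<^sup>2 - j)" by simp_all
  then obtain x y where xy: "i\<^sup>2 - i = 2 * x" "j\<^sup>2 - j = 2 * y" by (meson evenE)
  have "(i + j)\<^sup>2 - (i + j) = (i\<^sup>2 - i) + (j\<^sup>2 - j) + 2 * (i * j)"
    by (simp add: power2_eq_square algebra_simps)
  also have "\<dots> = 2 * (x + y + i * j)" by (simp only: xy distrib_left)
  finally show ?thesis by (simp only: xy) simp
qed

text \<open>Collects what the analysis uses of the semigroup. Uniqueness of normal forms is spent on
  constructing \<open>r\<close>.\<close>

locale bicyclic_degree =
  fixes p q :: "'a::{monoid_mult, discrete_topology}" and r :: "'a \<Rightarrow> int"
  assumes pq: "p * q = 1"
    and normal_form: "\<exists>m n. s = q ^ m * p ^ n"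
    and r_normal_form: "r (q ^ m * p ^ n) = int m - int n"
    and r_mult: "r (s * t) = r s + r t"
begin

lemma r_one: "r 1 = 0"
  using r_normal_form[of 0 0] by simp

lemma r_q: "r q = 1"
  using r_normal_form[of 1 0] by simp

text \<open>The relation \<open>p * q = 1\<close> forces the values at \<open>p\<close> and
  \<open>q\<close> to be inverse to each other, so a normal form contributes only its
  degree.\<close>

lemma character_eq_powi:
  fixes \<phi> :: "'a \<Rightarrow> complex"
  assumes mult: "\<And>s t. \<phi> (s * t) = \<phi> s * \<phi> t" and one: "\<phi> 1 = 1"
  shows "\<phi> s = \<phi> q powi r s"
proof -
  have pow: "\<phi> (x ^ n) = \<phi> x ^ n" for x n
    by (induction n) (simp_all add: one mult)
  have inv: "\<phi> p * \<phi> q = 1" using mult[of p q] one pq by simp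
  then have p: "\<phi> p = inverse (\<phi> q)" and q: "\<phi> q \<noteq> 0"
    by (auto simp: inverse_unique mult.commute)
  obtain m n where s: "s = q ^ m * p ^ n" using normal_form by blast
  have "\<phi> s = \<phi> q ^ m * inverse (\<phi> q) ^ n" by (simp add: s mult pow p)
  also have "\<dots> = \<phi> q powi (int m - int n)"
    using q by (simp add: power_int_diff field_simps)
  finally show ?thesis by (simp add: s r_normal_form)
qed

section \<open>The levels 1 and 2 of \<open>F_fun\<close>\<close>

definition char_fun :: "complex \<Rightarrow> complex \<Rightarrow> 'a \<Rightarrow> complex" where
  "char_fun c a s = c * a powi r s"

text \<open>The exponent of \<open>b\<close> vanishes in degrees 0 and 1, so the values at
  \<open>1\<close> and \<open>q\<close> are \<open>c\<close> and \<open>c * a\<close>.\<close>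

definition quad_fun :: "complex \<Rightarrow> complex \<Rightarrow> complex \<Rightarrow> 'a \<Rightarrow> complex" where
  "quad_fun c a b s = c * a powi r s * b powi (((r s)\<^sup>2 - r s) div 2)"

lemma F_fun_1:
  "F_fun (Suc 0) = {char_fun c a | c a. cmod c = 1 \<and> cmod a = 1}"
proof (intro set_eqI iffI)
  fix f :: "'a \<Rightarrow> complex"
  assume f: "f \<in> F_fun (Suc 0)"
  then have unit: "cmod (f s) = 1" for s by simp
  have f1: "f 1 \<noteq> 0" using unit[of 1] by auto
  have translate: "f (s * t) = f s * f t / f 1" for s t
  proof -
    \<comment> \<open>The constant depends on \<open>t\<close> only, and \<open>s = 1\<close>
      identifies it as \<open>f t / f 1\<close>; thus \<open>f / f 1\<close> is
      multiplicative.\<close>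
    from F_fun_Suc_evaluation[OF f, of t] obtain c where c: "\<And>s. f (s * t) = c * f s"
      by auto
    show ?thesis using c[of s] c[of 1] f1 by (simp add: field_simps)
  qed
  have "f s / f 1 = (f q / f 1) powi r s" for s
    using f1 by (intro character_eq_powi) (simp_all add: translate)
  then have "f s = f 1 * (f q / f 1) powi r s" for s
    using f1 by (metis nonzero_divide_eq_eq mult.commute)
  then have "f = char_fun (f 1) (f q / f 1)"
    unfolding char_fun_def by (intro ext)
  moreover have "cmod (f q / f 1) = 1" using unit by (simp add: norm_divide)
  ultimately show "f \<in> {char_fun c a | c a. cmod c = 1 \<and> cmod a = 1}"
    by (intro CollectI exI conjI) (assumption | rule unit)+
next
  fix f :: "'a \<Rightarrow> complex"
  assume "f \<in> {char_fun c a | c a. cmod c = 1 \<and> cmod a = 1}"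
  then obtain c a where f: "f = char_fun c a" and ca: "cmod c = 1" "cmod a = 1" by blast
  have a0: "a \<noteq> 0" using ca by auto
  have unit: "cmod (f s) = 1" for s
    using ca by (simp add: f char_fun_def norm_mult cmod_powi_one)
  have "\<exists>g \<in> F_fun 0. T_op \<mu> f = (\<lambda>s. g s * f s)" if \<mu>: "\<mu> \<in> spectrum LMC" for \<mu>
  proof -
    let ?h = "\<lambda>t. a powi r t"
    have h: "cmod (?h t) = 1" for t using ca by (simp add: cmod_powi_one)
    have "?h \<in> LMC" using h by (intro LMC_discreteI[of _ 1]) simp
    \<comment> \<open>The variables separate, so the functional acts on \<open>?h\<close> alone and
      produces a scalar.\<close>
    have "left_translate s f = (\<lambda>t. f s * ?h t)" for s
      using a0 by (auto simp: left_translate_def f char_fun_def r_mult power_int_add)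
    then have "T_op \<mu> f = (\<lambda>s. \<mu> ?h * f s)"
      using spectrum_scale[OF \<mu> \<open>?h \<in> LMC\<close>] by (simp add: T_op_def mult.commute)
    moreover have "(\<lambda>s. \<mu> ?h) \<in> F_fun 0" using spectrum_LMC_unimodular[OF \<mu> h] by auto
    ultimately show ?thesis by (rule bexI[of _ "\<lambda>s. \<mu> ?h"])
  qed
  with unit show "f \<in> F_fun (Suc 0)" by (rule F_fun_SucI)
qed

lemma F_fun_2:
  "F_fun (Suc (Suc 0)) = {quad_fun c a b | c a b. cmod c = 1 \<and> cmod a = 1 \<and> cmod b = 1}"
proof (intro set_eqI iffI)
  fix f :: "'a \<Rightarrow> complex"
  assume f: "f \<in> F_fun (Suc (Suc 0))"
  then have unit: "cmod (f s) = 1" for s by simp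
  have f0: "f s \<noteq> 0" for s using unit[of s] by auto
  have "\<exists>a. cmod a = 1 \<and> (\<forall>s. f (s * t) = f s * f t / f 1 * a powi r s)" for t
  proof -
    from F_fun_Suc_evaluation[OF f, of t] obtain c a where a: "cmod a = 1"
      and "\<forall>s. f (s * t) = char_fun c a s * f s"
      unfolding F_fun_1 by blast
    then have c: "f (s * t) = c * a powi r s * f s" for s
      by (simp add: char_fun_def)
    have "c = f t / f 1" using c[of 1] f0 by (simp add: r_one)
    then show ?thesis using c a by (intro exI[of _ a]) simp
  qed
  then obtain a where a: "\<And>t. cmod (a t) = 1"
    and translate: "\<And>s t. f (s * t) = f s * f t / f 1 * a t powi r s" by metis
  \<comment> \<open>Both bracketings of \<open>q * t * u\<close> are expanded by
    \<open>translate\<close>. Since \<open>r q = 1\<close>, cancelling the common factors leaves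
    exactly this identity.\<close>
  have a_mult: "a (t * u) = a t * a u" for t u
  proof -
    have "a u \<noteq> 0" using a[of u] by auto
    moreover from this have "f ((q * t) * u) =
        (f q * f t / f 1 * a t) * f u / f 1 * (a u * a u powi r t)"
      by (simp add: translate r_mult r_q power_int_add)
    moreover have "f (q * (t * u)) = f q * (f t * f u / f 1 * a u powi r t) / f 1 * a (t * u)"
      by (simp add: translate r_q)
    ultimately show ?thesis
      using f0 by (simp add: mult.assoc)
  qed
  have "a 1 \<noteq> 0" using a[of 1] by auto
  then have a_one: "a 1 = 1" using a_mult[of 1 1] by simp
  define b where "b = a q"
  have b: "cmod b = 1" "b \<noteq> 0" using a[of q] by (auto simp: b_def)
  have a_eq: "a t = b powi r t" for t
    unfolding b_def using a_mult a_one by (rule character_eq_powi)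
  have powi_powi: "(b powi r t) powi r s = b powi (r s * r t)" for s t
    using power_int_mult[of b "r t" "r s"] by (simp only: mult.commute)
  \<comment> \<open>By \<open>a_eq\<close>, \<open>f / f 1\<close> is multiplicative up to
    \<open>b powi (r s * r t)\<close>, which is the cross term of \<open>triangular_add\<close>; the
    division removes it.\<close>
  define \<phi> where "\<phi> s = f s / f 1 / b powi (((r s)\<^sup>2 - r s) div 2)" for s
  have "\<phi> (s * t) = \<phi> s * \<phi> t" for s t
    using b f0
    by (simp add: \<phi>_def translate a_eq powi_powi r_mult triangular_add power_int_add)
  moreover have "\<phi> 1 = 1" using f0 by (simp add: \<phi>_def r_one)
  ultimately have \<phi>: "\<phi> s = \<phi> q powi r s" for s by (rule character_eq_powi)
  have "f s = quad_fun (f 1) (\<phi> q) b s" for s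
    unfolding quad_fun_def \<phi>[symmetric] using b f0 by (simp add: \<phi>_def)
  then have "f = quad_fun (f 1) (\<phi> q) b" by (intro ext)
  moreover have "cmod (\<phi> q) = 1" using unit by (simp add: \<phi>_def r_q norm_divide)
  ultimately show "f \<in> {quad_fun c a b | c a b. cmod c = 1 \<and> cmod a = 1 \<and> cmod b = 1}"
    by (intro CollectI exI conjI) (assumption | rule unit b(1))+
next
  fix f :: "'a \<Rightarrow> complex"
  assume "f \<in> {quad_fun c a b | c a b. cmod c = 1 \<and> cmod a = 1 \<and> cmod b = 1}"
  then obtain c a b where f: "f = quad_fun c a b"
    and abc: "cmod c = 1" "cmod a = 1" "cmod b = 1" by blast
  have nz: "a \<noteq> 0" "b \<noteq> 0" "c \<noteq> 0" using abc by auto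
  have unit: "cmod (f s) = 1" for s
    using abc by (simp add: f quad_fun_def norm_mult cmod_powi_one)
  then have LMC: "f \<in> LMC" by (intro LMC_discreteI[of _ 1]) simp
  have "\<exists>g \<in> F_fun (Suc 0). T_op \<mu> f = (\<lambda>s. g s * f s)" if \<mu>: "\<mu> \<in> spectrum LMC" for \<mu>
  proof -
    let ?h = "\<lambda>t. b powi r t"
    have h: "cmod (?h t) = 1" for t using abc by (simp add: cmod_powi_one)
    have hk: "(\<lambda>t. ?h t powi k) \<in> LMC" for k
      using h by (intro LMC_discreteI[of _ 1]) (simp add: cmod_powi_one)
    have fhk: "(\<lambda>t. f t * ?h t powi k) \<in> LMC" for k
      using h unit by (intro LMC_discreteI[of _ 1]) (simp add: norm_mult cmod_powi_one)
    \<comment> \<open>The division by \<open>c\<close> compensates for the constant occurring in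
      both \<open>f s\<close> and \<open>f t\<close>. After \<open>\<mu>\<close> is applied, the
      factor multiplying \<open>f s\<close> depends on \<open>s\<close> only through a power with
      exponent \<open>r s\<close>, so it is a \<open>char_fun\<close>.\<close>
    have "left_translate s f = (\<lambda>t. f s / c * (f t * ?h t powi r s))" for s
    proof
      fix t
      have "?h t powi r s = b powi (r s * r t)"
        using power_int_mult[of b "r t" "r s"] by (simp only: mult.commute)
      then show "left_translate s f t = f s / c * (f t * ?h t powi r s)"
        using nz by (simp add: left_translate_def f quad_fun_def r_mult triangular_add power_int_add)
    qed
    then have "T_op \<mu> f s = f s / c * (\<mu> f * \<mu> ?h powi r s)" for s
      by (simp only: T_op_def spectrum_scale[OF \<mu> fhk] spectrum_mult[OF \<mu> LMC hk]
          spectrum_LMC_powi[OF \<mu> h])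
    then have "T_op \<mu> f = (\<lambda>s. char_fun (\<mu> f / c) (\<mu> ?h) s * f s)"
      by (auto simp: char_fun_def)
    moreover have "char_fun (\<mu> f / c) (\<mu> ?h) \<in> F_fun (Suc 0)"
    proof -
      have "cmod (\<mu> f / c) = 1" "cmod (\<mu> ?h) = 1"
        using spectrum_LMC_unimodular[OF \<mu> h] spectrum_LMC_unimodular[OF \<mu> unit] abc
        by (simp_all add: norm_divide)
      then show ?thesis unfolding F_fun_1 by blast
    qed
    ultimately show ?thesis by blast
  qed
  with unit show "f \<in> F_fun (Suc (Suc 0))" by (rule F_fun_SucI)
qed

section \<open>Interpolating the exponents\<close>

lemma normal_form_all: "(\<forall>m n. P (q ^ m * p ^ n) (int m - int n)) \<longleftrightarrow> (\<forall>s. P s (r s))"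
  by (metis normal_form r_normal_form)

text \<open>The exponents are the Lagrange polynomials for the nodes 0 and 1, so
  \<open>\<nu>\<close> and \<open>\<mu>\<close> are the values in those degrees.\<close>

lemma char_fun_interpolate:
  assumes "\<nu> \<noteq> 0"
  shows "char_fun \<nu> (\<mu> / \<nu>) s = \<mu> powi r s * \<nu> powi (1 - r s)"
  using assms by (simp add: char_fun_def power_int_diff power_int_divide_distrib)

lemma F_fun_1_interpolate:
  "F_fun (Suc 0) = {f. \<exists>\<mu> \<nu>. cmod \<mu> = 1 \<and> cmod \<nu> = 1 \<and>
     (\<forall>s. f s = \<mu> powi r s * \<nu> powi (1 - r s))}" (is "_ = ?R")
proof (intro set_eqI iffI)
  fix f :: "'a \<Rightarrow> complex"
  assume "f \<in> F_fun (Suc 0)"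
  then obtain c a where f: "f = char_fun c a" and ca: "cmod c = 1" "cmod a = 1"
    unfolding F_fun_1 by blast
  then have "c \<noteq> 0" by auto
  then have "f s = (c * a) powi r s * c powi (1 - r s)" for s
    using char_fun_interpolate[of c "c * a" s] by (simp add: f)
  moreover have "cmod (c * a) = 1" using ca by (simp add: norm_mult)
  ultimately show "f \<in> ?R" using ca by blast
next
  fix f assume "f \<in> ?R"
  then obtain \<mu> \<nu> where u: "cmod \<mu> = 1" "cmod \<nu> = 1"
    and f: "\<And>s. f s = \<mu> powi r s * \<nu> powi (1 - r s)" by blast
  have "\<nu> \<noteq> 0" using u by auto
  then have "f = char_fun \<nu> (\<mu> / \<nu>)" by (simp add: fun_eq_iff f char_fun_interpolate)
  moreover have "cmod (\<mu> / \<nu>) = 1" using u by (simp add: norm_divide)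
  ultimately show "f \<in> F_fun (Suc 0)" unfolding F_fun_1 using u by blast
qed

text \<open>The exponents are the Lagrange polynomials for the nodes -1, 0 and 1, with values
  \<open>l\<close>, \<open>\<nu>\<close>, \<open>\<mu>\<close> there. Solving
  \<open>c = \<nu>\<close>, \<open>c * a = \<mu>\<close>, \<open>c * b / a = l\<close> gives the
  arguments of \<open>quad_fun\<close>.\<close>

lemma quad_fun_interpolate:
  assumes "\<nu> \<noteq> 0" "\<mu> \<noteq> 0" "l \<noteq> 0"
  shows "quad_fun \<nu> (\<mu> / \<nu>) (l * \<mu> / \<nu>\<^sup>2) s =
    l powi (((r s)\<^sup>2 - r s) div 2) * \<mu> powi (((r s)\<^sup>2 + r s) div 2) * \<nu> powi (1 - (r s)\<^sup>2)"
proof -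
  define k where "k = ((r s)\<^sup>2 - r s) div 2"
  have "even ((r s)\<^sup>2 - r s)" by simp
  \<comment> \<open>All three exponents become linear in \<open>r s\<close> and \<open>k\<close>,
    without integer division.\<close>
  then have k: "(r s)\<^sup>2 = r s + k + k" by (auto simp: k_def elim!: evenE)
  then have m: "((r s)\<^sup>2 + r s) div 2 = k + r s" by simp
  have double: "\<nu> powi (2 * k) = \<nu> powi k * \<nu> powi k"
    unfolding mult_2 using assms(1) by (intro power_int_add) simp
  have n: "\<nu> powi (1 - (r s)\<^sup>2) = \<nu> / (\<nu> powi r s * \<nu> powi k * \<nu> powi k)"
    using assms by (simp add: k power_int_diff power_int_add double)
  show ?thesis using assms
    unfolding quad_fun_def k_def[symmetric] m n
    by (simp add: power_int_divide_distrib power_int_mult_distrib power_int_add divide_simps)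
      (simp add: double power2_eq_square power_int_mult_distrib)
qed

lemma F_fun_2_interpolate:
  "F_fun (Suc (Suc 0)) = {f. \<exists>l \<mu> \<nu>. cmod l = 1 \<and> cmod \<mu> = 1 \<and> cmod \<nu> = 1 \<and>
     (\<forall>s. f s = l powi (((r s)\<^sup>2 - r s) div 2) * \<mu> powi (((r s)\<^sup>2 + r s) div 2) *
        \<nu> powi (1 - (r s)\<^sup>2))}" (is "_ = ?R")
proof (intro set_eqI iffI)
  fix f :: "'a \<Rightarrow> complex"
  assume "f \<in> F_fun (Suc (Suc 0))"
  then obtain c a b where f: "f = quad_fun c a b"
    and abc: "cmod c = 1" "cmod a = 1" "cmod b = 1"
    unfolding F_fun_2 by blast
  then have nz: "a \<noteq> 0" "b \<noteq> 0" "c \<noteq> 0" by auto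
  \<comment> \<open>The new parameters are the values of \<open>f\<close> in degrees -1, 1 and 0;
    this recovers \<open>b\<close> from them.\<close>
  have "c * b / a * (c * a) / c\<^sup>2 = b" using nz by (simp add: power2_eq_square)
  then have "f s = (c * b / a) powi (((r s)\<^sup>2 - r s) div 2) * (c * a) powi (((r s)\<^sup>2 + r s) div 2) *
        c powi (1 - (r s)\<^sup>2)" for s
    using quad_fun_interpolate[of c "c * a" "c * b / a" s] nz by (simp add: f)
  moreover have "cmod (c * b / a) = 1" "cmod (c * a) = 1"
    using abc by (simp_all add: norm_mult norm_divide)
  ultimately show "f \<in> ?R" using abc by blast
next
  fix f assume "f \<in> ?R"
  then obtain l \<mu> \<nu> where u: "cmod l = 1" "cmod \<mu> = 1" "cmod \<nu> = 1"
    and f: "\<And>s. f s = l powi (((r s)\<^sup>2 - r s) div 2) * \<mu> powi (((r s)\<^sup>2 + r s) div 2) *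
        \<nu> powi (1 - (r s)\<^sup>2)" by blast
  have "\<nu> \<noteq> 0" "\<mu> \<noteq> 0" "l \<noteq> 0" using u by auto
  then have "f = quad_fun \<nu> (\<mu> / \<nu>) (l * \<mu> / \<nu>\<^sup>2)" by (simp add: fun_eq_iff f quad_fun_interpolate)
  moreover have "cmod (\<mu> / \<nu>) = 1" "cmod (l * \<mu> / \<nu>\<^sup>2) = 1"
    using u by (simp_all add: norm_mult norm_divide norm_power)
  ultimately show "f \<in> F_fun (Suc (Suc 0))" unfolding F_fun_2 using u by blast
qed

end

section \<open>Construction of the degree homomorphism\<close>

lemma bicyclic_degree_exists:
  fixes p q :: "'a::{monoid_mult, discrete_topology}"
  assumes "bicyclic p q"
  shows "\<exists>r. bicyclic_degree p q r"
proof -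
  have pq: "p * q = 1" using assms by (simp add: bicyclic_def)
  have nf: "\<exists>m n. s = q ^ m * p ^ n" for s
    using bicyclic_normal_form[OF assms, of s] by auto
  have inj: "m = k \<and> n = l" if "q ^ m * p ^ n = q ^ k * p ^ l" for m n k l
    using bicyclic_normal_form[OF assms, of "q ^ m * p ^ n"] that by blast
  \<comment> \<open>The description is well defined because \<open>inj\<close> makes the exponents
    unique.\<close>
  define r where "r s = (THE d. \<exists>m n. s = q ^ m * p ^ n \<and> d = int m - int n)" for s
  have r: "r (q ^ m * p ^ n) = int m - int n" for m n
    unfolding r_def using inj by (intro the_equality) blast+
  have "r (s * t) = r s + r t" for s t
  proof -
    obtain m n k l where st: "s = q ^ m * p ^ n" "t = q ^ k * p ^ l" using nf by meson
    have "s * t = q ^ m * (p ^ n * q ^ k) * p ^ l" by (simp add: st mult.assoc)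
    also have "\<dots> = q ^ (m + (k - n)) * p ^ ((n - k) + l)"
      by (simp add: bicyclic_power_mult[OF pq] power_add mult.assoc)
    \<comment> \<open>The subtractions on naturals truncate, but
      \<open>int (k - n) - int (n - k)\<close> equals \<open>int k - int n\<close> in either
      case.\<close>
    finally have "r (s * t) = int (m + (k - n)) - int ((n - k) + l)" by (simp only: r)
    then show ?thesis by (simp add: st r)
  qed
  then show ?thesis using pq nf r by (intro exI[of _ r] bicyclic_degree.intro)
qed

theorem theorem4p5:
  fixes p q :: "'a::{monoid_mult, discrete_topology}"
  assumes "bicyclic p q"
  shows "(W 1 :: ('a \<Rightarrow>\<^sub>C complex) set) = closed_algebra
           {f. \<exists>\<mu> \<nu>. cmod \<mu> = 1 \<and> cmod \<nu> = 1 \<and>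
             (\<forall>m n. let r = int m - int n in
               f (q ^ m * p ^ n) = \<mu> powi r * \<nu> powi (1 - r))} \<and>
         (W 2 :: ('a \<Rightarrow>\<^sub>C complex) set) = closed_algebra
           {f. \<exists>lam \<mu> \<nu>. cmod lam = 1 \<and> cmod \<mu> = 1 \<and> cmod \<nu> = 1 \<and>
             (\<forall>m n. let r = int m - int n in
               f (q ^ m * p ^ n) = lam powi ((r\<^sup>2 - r) div 2) * \<mu> powi ((r\<^sup>2 + r) div 2) * \<nu> powi (1 - r\<^sup>2))}"
proof -
  obtain r where "bicyclic_degree p q r" using bicyclic_degree_exists[OF assms] by blast
  then interpret bicyclic_degree p q r .
  have W: "(W 1 :: ('a \<Rightarrow>\<^sub>C complex) set) = closed_algebra (F_fun (Suc 0))"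
      "(W 2 :: ('a \<Rightarrow>\<^sub>C complex) set) = closed_algebra (F_fun (Suc (Suc 0)))"
    by (simp_all only: W_def One_nat_def numeral_2_eq_2)
  have 1: "(\<forall>m n. let r = int m - int n in f (q ^ m * p ^ n) = \<mu> powi r * \<nu> powi (1 - r)) \<longleftrightarrow>
      (\<forall>s. f s = \<mu> powi r s * \<nu> powi (1 - r s))" for f \<mu> \<nu>
    unfolding Let_def by (rule normal_form_all[where P = "\<lambda>s d. f s = \<mu> powi d * \<nu> powi (1 - d)"])
  have 2: "(\<forall>m n. let r = int m - int n in f (q ^ m * p ^ n) =
        l powi ((r\<^sup>2 - r) div 2) * \<mu> powi ((r\<^sup>2 + r) div 2) * \<nu> powi (1 - r\<^sup>2)) \<longleftrightarrow>
      (\<forall>s. f s = l powi (((r s)\<^sup>2 - r s) div 2) * \<mu> powi (((r s)\<^sup>2 + r s) div 2) *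
        \<nu> powi (1 - (r s)\<^sup>2))" for f l \<mu> \<nu>
    unfolding Let_def by (rule normal_form_all[where P = "\<lambda>s d. f s = l powi ((d\<^sup>2 - d) div 2) *
        \<mu> powi ((d\<^sup>2 + d) div 2) * \<nu> powi (1 - d\<^sup>2)"])
  show ?thesis
    unfolding W F_fun_1_interpolate F_fun_2_interpolate 1 2 by (intro conjI refl)
qed

end
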